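(* Let $R$ be a local Krasner hyperdomain with maximal hyperideal $M$, let $\Delta$ be the set of all $M$-primary hyperideals of $R$, suppose that every hyperideal in $\Delta$ is normal, and let $\Theta$ be the set of all hypervaluation hyperideals of $R$. If $\Delta\subseteq\Theta$, then $\Delta$ is totally ordered by inclusion and $\bigcap_{Q\in\Delta}Q$ is a prime hyperideal of $R$.
   Context: A Krasner hyperring is a set $R$ with a hyperoperation $+$ (assigning to each pair $x,y$ a nonempty subset $x+y\subseteq R$) and a binary operation $\cdot$ such that: (1) $(R,+)$ is a canonical hypergroup: $+$ is associative and commutative, there is $0\in R$ with $0+x=\{x\}$ for all $x$, each $x$ has a unique opposite $-x$ with $0\in x+(-x)$, and $z\in x+y$ implies $y\in -x+z$ and $x\in z-y$; (2) $(R,\cdot)$ is a semigroup with $x\cdot 0=0\cdot x=0$; (3) $\cdot$ is distributive over $+$. Sums and products of subsets are taken as unions over elements, and $x-y=x+(-y)$. All hyperrings are commutative with unit element $1$. A hyperdomain is such a hyperring in which $ab=0$ implies $a=0$ or $b=0$; a hyperfield is one whose nonzero elements form a group under multiplication. A hyperideal of $R$ is a nonempty $I\subseteq R$ with $a-b\subseteq I$ and $ar\in I$ for all $a,b\in I$, $r\in R$. A hyperideal $I$ is normal if $r+I-r\subseteq I$ for every $r\in R$. A proper hyperideal $P$ is prime if $ab\in P$ implies $a\in P$ or $b\in P$. The radical is $\sqrt{I}=\{x\in R: x^n\in I \text{ for some positive integer } n\}$. A proper hyperideal $Q$ is primary if $xy\in Q$ implies $x\in Q$ or $y\in\sqrt{Q}$;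 it is $P$-primary if moreover $\sqrt{Q}=P$. A hyperring is local if it has a unique maximal hyperideal. For a Krasner hyperdomain $R$, $Q(R)$ is its quotient hyperfield (hyperfield of fractions): fractions $a/b$ with $b\ne 0$, usual equality and product, and $a/b+c/d=\{x/(bd): x\in ad+bc\}$; $R$ is regarded as a subset of $Q(R)$. A hypervaluation hyperring $V$ of $Q(R)$ is a subhyperring of $Q(R)$ such that for every nonzero $a\in Q(R)$, $a\in V$ or $a^{-1}\in V$. A hyperideal $I$ of $R$ is a hypervaluation hyperideal if there are a hypervaluation hyperring $V$ of $Q(R)$ containing $R$ and a hyperideal $J$ of $V$ with $I=J\cap R$. *)

theory Defs
  imports "HOL-Algebra.Group"
begin

section \<open>Commutative Krasner hyperrings with unit\<close>

record 'a hyperring = "'a monoid" +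
  hzero :: 'a ("\<zero>\<index>")
  hadd :: "'a \<Rightarrow> 'a \<Rightarrow> 'a set" (infixl "\<uplus>\<index>" 65)

definition hopp :: "('a, 'b) hyperring_scheme \<Rightarrow> 'a \<Rightarrow> 'a" where
  "hopp R x = (THE y. y \<in> carrier R \<and> \<zero>\<^bsub>R\<^esub> \<in> x \<uplus>\<^bsub>R\<^esub> y)"

definition hdiff :: "('a, 'b) hyperring_scheme \<Rightarrow> 'a \<Rightarrow> 'a \<Rightarrow> 'a set" where
  "hdiff R x y = x \<uplus>\<^bsub>R\<^esub> hopp R y"

locale canonical_hypergroup =
  fixes R :: "('a, 'b) hyperring_scheme" (structure)
  assumes hadd_closed: "\<lbrakk>x \<in> carrier R; y \<in> carrier R\<rbrakk> \<Longrightarrow> x \<uplus> y \<subseteq> carrier R"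
    and hadd_nonempty: "\<lbrakk>x \<in> carrier R; y \<in> carrier R\<rbrakk> \<Longrightarrow> x \<uplus> y \<noteq> {}"
    and hadd_assoc: "\<lbrakk>x \<in> carrier R; y \<in> carrier R; z \<in> carrier R\<rbrakk>
      \<Longrightarrow> (\<Union>u \<in> x \<uplus> y. u \<uplus> z) = (\<Union>u \<in> y \<uplus> z. x \<uplus> u)"
    and hadd_comm: "\<lbrakk>x \<in> carrier R; y \<in> carrier R\<rbrakk> \<Longrightarrow> x \<uplus> y = y \<uplus> x"
    and hzero_closed: "\<zero> \<in> carrier R"
    and hzero_hadd: "x \<in> carrier R \<Longrightarrow> \<zero> \<uplus> x = {x}"
    and hopp_unique: "x \<in> carrier R \<Longrightarrow> \<exists>!y. y \<in> carrier R \<and> \<zero> \<in> x \<uplus> y"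
    and hadd_reversible: "\<lbrakk>x \<in> carrier R; y \<in> carrier R; z \<in> x \<uplus> y\<rbrakk>
      \<Longrightarrow> y \<in> hopp R x \<uplus> z \<and> x \<in> hdiff R z y"

text \<open>Multiplication is commutative, so one-sided forms of the absorption and distributivity
  axioms suffice.\<close>

locale krasner_hyperring = canonical_hypergroup R + comm_monoid R
  for R :: "('a, 'b) hyperring_scheme" (structure) +
  assumes mult_hzero: "x \<in> carrier R \<Longrightarrow> x \<otimes> \<zero> = \<zero>"
    and mult_hadd_distrib: "\<lbrakk>a \<in> carrier R; x \<in> carrier R; y \<in> carrier R\<rbrakk>
      \<Longrightarrow> (\<lambda>u. a \<otimes> u) ` (x \<uplus> y) = (a \<otimes> x) \<uplus> (a \<otimes> y)"

locale krasner_hyperdomain = krasner_hyperring R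
  for R :: "('a, 'b) hyperring_scheme" (structure) +
  assumes no_zero_divisors: "\<lbrakk>a \<in> carrier R; b \<in> carrier R; a \<otimes> b = \<zero>\<rbrakk> \<Longrightarrow> a = \<zero> \<or> b = \<zero>"

definition subhyperring :: "('a, 'b) hyperring_scheme \<Rightarrow> 'a set \<Rightarrow> bool" where
  "subhyperring R S \<longleftrightarrow> S \<subseteq> carrier R \<and> krasner_hyperring (R\<lparr>carrier := S\<rparr>)"


section \<open>Hyperideals\<close>

definition hyperideal :: "('a, 'b) hyperring_scheme \<Rightarrow> 'a set \<Rightarrow> bool" where
  "hyperideal R I \<longleftrightarrow> I \<noteq> {} \<and> I \<subseteq> carrier R \<and>
     (\<forall>a \<in> I. \<forall>b \<in> I. hdiff R a b \<subseteq> I) \<and>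
     (\<forall>a \<in> I. \<forall>r \<in> carrier R. a \<otimes>\<^bsub>R\<^esub> r \<in> I)"

definition normal_hyperideal :: "('a, 'b) hyperring_scheme \<Rightarrow> 'a set \<Rightarrow> bool" where
  "normal_hyperideal R I \<longleftrightarrow> hyperideal R I \<and>
     (\<forall>r \<in> carrier R. (\<Union>i \<in> I. \<Union>u \<in> r \<uplus>\<^bsub>R\<^esub> i. hdiff R u r) \<subseteq> I)"

definition prime_hyperideal :: "('a, 'b) hyperring_scheme \<Rightarrow> 'a set \<Rightarrow> bool" where
  "prime_hyperideal R P \<longleftrightarrow> hyperideal R P \<and> P \<noteq> carrier R \<and>
     (\<forall>a \<in> carrier R. \<forall>b \<in> carrier R. a \<otimes>\<^bsub>R\<^esub> b \<in> P \<longrightarrow> a \<in> P \<or> b \<in> P)"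

definition hradical :: "('a, 'b) hyperring_scheme \<Rightarrow> 'a set \<Rightarrow> 'a set" where
  "hradical R I = {x \<in> carrier R. \<exists>n::nat. n > 0 \<and> x [^]\<^bsub>R\<^esub> n \<in> I}"

definition primary_hyperideal :: "('a, 'b) hyperring_scheme \<Rightarrow> 'a set \<Rightarrow> bool" where
  "primary_hyperideal R Q \<longleftrightarrow> hyperideal R Q \<and> Q \<noteq> carrier R \<and>
     (\<forall>x \<in> carrier R. \<forall>y \<in> carrier R. x \<otimes>\<^bsub>R\<^esub> y \<in> Q \<longrightarrow> x \<in> Q \<or> y \<in> hradical R Q)"

definition primary_hyperideal_of :: "('a, 'b) hyperring_scheme \<Rightarrow> 'a set \<Rightarrow> 'a set \<Rightarrow> bool" where
  "primary_hyperideal_of R P Q \<longleftrightarrow> primary_hyperideal R Q \<and> hradical R Q = P"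

definition maximal_hyperideal :: "('a, 'b) hyperring_scheme \<Rightarrow> 'a set \<Rightarrow> bool" where
  "maximal_hyperideal R M \<longleftrightarrow> hyperideal R M \<and> M \<noteq> carrier R \<and>
     (\<forall>J. hyperideal R J \<and> M \<subseteq> J \<longrightarrow> J = M \<or> J = carrier R)"

definition local_hyperring :: "('a, 'b) hyperring_scheme \<Rightarrow> bool" where
  "local_hyperring R \<longleftrightarrow> krasner_hyperring R \<and> (\<exists>!M. maximal_hyperideal R M)"


section \<open>The quotient hyperfield and hypervaluation hyperideals\<close>

definition frac_rel :: "('a, 'b) hyperring_scheme \<Rightarrow> (('a \<times> 'a) \<times> ('a \<times> 'a)) set" where
  "frac_rel R = {((a, b), (c, d)) | a b c d.
     a \<in> carrier R \<and> b \<in> carrier R - {\<zero>\<^bsub>R\<^esub>} \<and> c \<in> carrier R \<and> d \<in> carrier R - {\<zero>\<^bsub>R\<^esub>} \<and>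
     a \<otimes>\<^bsub>R\<^esub> d = b \<otimes>\<^bsub>R\<^esub> c}"

definition hfrac :: "('a, 'b) hyperring_scheme \<Rightarrow> 'a \<Rightarrow> 'a \<Rightarrow> ('a \<times> 'a) set" where
  "hfrac R a b = frac_rel R `` {(a, b)}"

text \<open>The operations on classes range over all representatives; the lemmas
  \<open>quotient_hyperfield_hadd\<close> and \<open>quotient_hyperfield_mult\<close> below show that they are given
  by the usual formulas on any choice of representatives.\<close>

definition quotient_hyperfield :: "('a, 'b) hyperring_scheme \<Rightarrow> ('a \<times> 'a) set hyperring" where
  "quotient_hyperfield R = \<lparr>
     carrier = {hfrac R a b | a b. a \<in> carrier R \<and> b \<in> carrier R - {\<zero>\<^bsub>R\<^esub>}},
     mult = (\<lambda>X Y. \<Union>(a, b) \<in> X. \<Union>(c, d) \<in> Y. hfrac R (a \<otimes>\<^bsub>R\<^esub> c) (b \<otimes>\<^bsub>R\<^esub> d)),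
     one = hfrac R \<one>\<^bsub>R\<^esub> \<one>\<^bsub>R\<^esub>,
     hzero = hfrac R \<zero>\<^bsub>R\<^esub> \<one>\<^bsub>R\<^esub>,
     hadd = (\<lambda>X Y. \<Union>(a, b) \<in> X. \<Union>(c, d) \<in> Y.
       {hfrac R x (b \<otimes>\<^bsub>R\<^esub> d) | x. x \<in> (a \<otimes>\<^bsub>R\<^esub> d) \<uplus>\<^bsub>R\<^esub> (b \<otimes>\<^bsub>R\<^esub> c)})\<rparr>"

text \<open>The copy of an element of \<open>R\<close> inside the quotient hyperfield.\<close>

definition hembed :: "('a, 'b) hyperring_scheme \<Rightarrow> 'a \<Rightarrow> ('a \<times> 'a) set" where
  "hembed R a = hfrac R a \<one>\<^bsub>R\<^esub>"

definition hypervaluation_hyperring ::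
    "('a, 'b) hyperring_scheme \<Rightarrow> ('a \<times> 'a) set set \<Rightarrow> bool" where
  "hypervaluation_hyperring R V \<longleftrightarrow>
     subhyperring (quotient_hyperfield R) V \<and>
     (\<forall>a \<in> carrier (quotient_hyperfield R) - {\<zero>\<^bsub>quotient_hyperfield R\<^esub>}.
        a \<in> V \<or> inv\<^bsub>quotient_hyperfield R\<^esub> a \<in> V)"

definition hypervaluation_hyperideal :: "('a, 'b) hyperring_scheme \<Rightarrow> 'a set \<Rightarrow> bool" where
  "hypervaluation_hyperideal R I \<longleftrightarrow> hyperideal R I \<and>
     (\<exists>V J. hypervaluation_hyperring R V \<and> hembed R ` carrier R \<subseteq> V \<and>
        hyperideal ((quotient_hyperfield R)\<lparr>carrier := V\<rparr>) J \<and>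
        I = {a \<in> carrier R. hembed R a \<in> J})"

context krasner_hyperdomain
begin

lemma mult_left_cancel:
  assumes "a \<in> carrier R - {\<zero>}" "x \<in> carrier R" "y \<in> carrier R" "a \<otimes> x = a \<otimes> y"
  shows "x = y"
proof -
  obtain y' where y': "y' \<in> carrier R" "\<zero> \<in> y \<uplus> y'"
    using hopp_unique[OF assms(3)] by blast
  have "a \<otimes> \<zero> \<in> (\<lambda>u. a \<otimes> u) ` (y \<uplus> y')" using y' by blast
  then have "\<zero> \<in> (a \<otimes> x) \<uplus> (a \<otimes> y')"
    using assms(1,3) y'(1) mult_hzero mult_hadd_distrib[of a y y'] unfolding assms(4) by simp
  then have "\<zero> \<in> (\<lambda>u. a \<otimes> u) ` (x \<uplus> y')"
    using assms y' mult_hadd_distrib by auto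
  then obtain u where u: "u \<in> x \<uplus> y'" "a \<otimes> u = \<zero>" by auto
  moreover have "u \<in> carrier R" using u hadd_closed assms y' by blast
  ultimately have "\<zero> \<in> x \<uplus> y'" using no_zero_divisors assms by blast
  then have "\<zero> \<in> y' \<uplus> x" "\<zero> \<in> y' \<uplus> y" using y' assms hadd_comm by auto
  then show ?thesis using hopp_unique[OF y'(1)] assms by blast
qed

lemma frac_rel_equiv: "equiv (carrier R \<times> (carrier R - {\<zero>})) (frac_rel R)"
proof (rule equivI)
  show "frac_rel R \<subseteq> (carrier R \<times> (carrier R - {\<zero>})) \<times> (carrier R \<times> (carrier R - {\<zero>}))"
    by (auto simp: frac_rel_def)
  show "refl_on (carrier R \<times> (carrier R - {\<zero>})) (frac_rel R)"
    by (auto simp: refl_on_def frac_rel_def m_comm)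
  show "sym (frac_rel R)" by (auto simp: sym_def frac_rel_def m_comm)
  show "trans (frac_rel R)"
  proof (rule transI)
    fix p q r assume "(p, q) \<in> frac_rel R" "(q, r) \<in> frac_rel R"
    then obtain a b c d e f where *: "p = (a, b)" "r = (e, f)"
      "a \<in> carrier R" "b \<in> carrier R - {\<zero>}" "c \<in> carrier R" "d \<in> carrier R - {\<zero>}"
      "e \<in> carrier R" "f \<in> carrier R - {\<zero>}" "a \<otimes> d = b \<otimes> c" "c \<otimes> f = d \<otimes> e"
      by (auto simp: frac_rel_def)
    then have c: "a \<in> carrier R" "b \<in> carrier R" "c \<in> carrier R" "d \<in> carrier R"
      "e \<in> carrier R" "f \<in> carrier R" by auto
    have "d \<otimes> (a \<otimes> f) = (a \<otimes> d) \<otimes> f" using c by (simp add: m_ac)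
    also have "\<dots> = b \<otimes> (c \<otimes> f)" using c by (simp add: *(9) m_assoc)
    also have "\<dots> = b \<otimes> (d \<otimes> e)" by (simp add: *(10))
    also have "\<dots> = d \<otimes> (b \<otimes> e)" using c by (simp add: m_ac)
    finally have "a \<otimes> f = b \<otimes> e" using mult_left_cancel[OF *(6)] c by simp
    then show "(p, r) \<in> frac_rel R" using * by (auto simp: frac_rel_def)
  qed
qed

lemma hfrac_eq_iff:
  assumes "a \<in> carrier R" "b \<in> carrier R - {\<zero>}" "c \<in> carrier R" "d \<in> carrier R - {\<zero>}"
  shows "hfrac R a b = hfrac R c d \<longleftrightarrow> a \<otimes> d = b \<otimes> c"
  using assms eq_equiv_class_iff[OF frac_rel_equiv, of "(a, b)" "(c, d)"]
  by (auto simp: hfrac_def frac_rel_def)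

lemma mem_hfrac_iff:
  assumes "a \<in> carrier R" "b \<in> carrier R - {\<zero>}"
  shows "(c, d) \<in> hfrac R a b \<longleftrightarrow> c \<in> carrier R \<and> d \<in> carrier R - {\<zero>} \<and> a \<otimes> d = b \<otimes> c"
  using assms by (auto simp: hfrac_def frac_rel_def)

lemma mult_nonzero:
  "\<lbrakk>b \<in> carrier R - {\<zero>}; d \<in> carrier R - {\<zero>}\<rbrakk> \<Longrightarrow> b \<otimes> d \<in> carrier R - {\<zero>}"
  using no_zero_divisors by auto

lemma quotient_hyperfield_mult:
  assumes "a \<in> carrier R" "b \<in> carrier R - {\<zero>}" "c \<in> carrier R" "d \<in> carrier R - {\<zero>}"
  shows "hfrac R a b \<otimes>\<^bsub>quotient_hyperfield R\<^esub> hfrac R c d = hfrac R (a \<otimes> c) (b \<otimes> d)"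
proof -
  have eq: "hfrac R (a' \<otimes> c') (b' \<otimes> d') = hfrac R (a \<otimes> c) (b \<otimes> d)"
    if "(a', b') \<in> hfrac R a b" "(c', d') \<in> hfrac R c d" for a' b' c' d'
  proof -
    have *: "a' \<in> carrier R" "b' \<in> carrier R - {\<zero>}" "a \<otimes> b' = b \<otimes> a'"
      "c' \<in> carrier R" "d' \<in> carrier R - {\<zero>}" "c \<otimes> d' = d \<otimes> c'"
      using that assms mem_hfrac_iff by auto
    then have c: "a \<in> carrier R" "b \<in> carrier R" "c \<in> carrier R" "d \<in> carrier R"
      "a' \<in> carrier R" "b' \<in> carrier R" "c' \<in> carrier R" "d' \<in> carrier R"
      using assms by auto
    have "(a' \<otimes> c') \<otimes> (b \<otimes> d) = (b \<otimes> a') \<otimes> (d \<otimes> c')" using c by (simp add: m_ac)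
    also have "\<dots> = (a \<otimes> b') \<otimes> (c \<otimes> d')" by (simp only: *)
    also have "\<dots> = (b' \<otimes> d') \<otimes> (a \<otimes> c)" using c by (simp add: m_ac)
    finally show ?thesis
      using hfrac_eq_iff[of "a' \<otimes> c'" "b' \<otimes> d'" "a \<otimes> c" "b \<otimes> d"]
        mult_nonzero[OF *(2,5)] mult_nonzero[OF assms(2,4)] c by simp
  qed
  have "(a, b) \<in> hfrac R a b" "(c, d) \<in> hfrac R c d"
    using assms by (auto simp: mem_hfrac_iff m_comm)
  then have ne: "hfrac R a b \<noteq> {}" "hfrac R c d \<noteq> {}" by blast+
  have "hfrac R a b \<otimes>\<^bsub>quotient_hyperfield R\<^esub> hfrac R c d =
      (\<Union>p \<in> hfrac R a b. \<Union>q \<in> hfrac R c d. hfrac R (fst p \<otimes> fst q) (snd p \<otimes> snd q))"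
    by (simp add: quotient_hyperfield_def case_prod_unfold)
  also have "\<dots> = (\<Union>p \<in> hfrac R a b. \<Union>q \<in> hfrac R c d. hfrac R (a \<otimes> c) (b \<otimes> d))"
    by (intro SUP_cong refl eq) simp_all
  finally show ?thesis using ne by simp
qed

lemma quotient_hyperfield_hadd:
  assumes "a \<in> carrier R" "b \<in> carrier R - {\<zero>}" "c \<in> carrier R" "d \<in> carrier R - {\<zero>}"
  shows "hfrac R a b \<uplus>\<^bsub>quotient_hyperfield R\<^esub> hfrac R c d =
    {hfrac R x (b \<otimes> d) | x. x \<in> (a \<otimes> d) \<uplus> (b \<otimes> c)}"
proof -
  have sub: "hfrac R x (b' \<otimes> d') \<in> {hfrac R x (b \<otimes> d) | x. x \<in> (a \<otimes> d) \<uplus> (b \<otimes> c)}"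
    if "(a', b') \<in> hfrac R a b" "(c', d') \<in> hfrac R c d" "x \<in> (a' \<otimes> d') \<uplus> (b' \<otimes> c')"
    for a' b' c' d' x
  proof -
    have *: "a' \<in> carrier R" "b' \<in> carrier R - {\<zero>}" "a \<otimes> b' = b \<otimes> a'"
      "c' \<in> carrier R" "d' \<in> carrier R - {\<zero>}" "c \<otimes> d' = d \<otimes> c'"
      using that assms mem_hfrac_iff by auto
    then have c: "a \<in> carrier R" "b \<in> carrier R" "c \<in> carrier R" "d \<in> carrier R"
      "a' \<in> carrier R" "b' \<in> carrier R" "c' \<in> carrier R" "d' \<in> carrier R"
      using assms by auto
    have x: "x \<in> carrier R" using that(3) hadd_closed * c by blast
    have "(b \<otimes> d) \<otimes> (a' \<otimes> d') = (b' \<otimes> d') \<otimes> (a \<otimes> d)"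
    proof -
      have "(b \<otimes> d) \<otimes> (a' \<otimes> d') = (b \<otimes> a') \<otimes> (d \<otimes> d')" using c by (simp add: m_ac)
      also have "\<dots> = (a \<otimes> b') \<otimes> (d \<otimes> d')" by (simp only: *)
      also have "\<dots> = (b' \<otimes> d') \<otimes> (a \<otimes> d)" using c by (simp add: m_ac)
      finally show ?thesis .
    qed
    moreover have "(b \<otimes> d) \<otimes> (b' \<otimes> c') = (b' \<otimes> d') \<otimes> (b \<otimes> c)"
    proof -
      have "(b \<otimes> d) \<otimes> (b' \<otimes> c') = (d \<otimes> c') \<otimes> (b \<otimes> b')" using c by (simp add: m_ac)
      also have "\<dots> = (c \<otimes> d') \<otimes> (b \<otimes> b')" by (simp only: *)
      also have "\<dots> = (b' \<otimes> d') \<otimes> (b \<otimes> c)" using c by (simp add: m_ac)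
      finally show ?thesis .
    qed
    moreover have "(b \<otimes> d) \<otimes> x \<in> ((b \<otimes> d) \<otimes> (a' \<otimes> d')) \<uplus> ((b \<otimes> d) \<otimes> (b' \<otimes> c'))"
      using mult_hadd_distrib[of "b \<otimes> d" "a' \<otimes> d'" "b' \<otimes> c'"] that(3) c by auto
    ultimately have "(b \<otimes> d) \<otimes> x \<in> (\<lambda>u. (b' \<otimes> d') \<otimes> u) ` ((a \<otimes> d) \<uplus> (b \<otimes> c))"
      using mult_hadd_distrib[of "b' \<otimes> d'" "a \<otimes> d" "b \<otimes> c"] c by auto
    then obtain y where y: "y \<in> (a \<otimes> d) \<uplus> (b \<otimes> c)" "(b \<otimes> d) \<otimes> x = (b' \<otimes> d') \<otimes> y" by auto
    have yc: "y \<in> carrier R" using y(1) hadd_closed assms c by blast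
    have "hfrac R x (b' \<otimes> d') = hfrac R y (b \<otimes> d)"
      using y yc x c mult_nonzero * assms by (subst hfrac_eq_iff) (auto simp: m_comm)
    then show ?thesis using y(1) by blast
  qed
  have "(a, b) \<in> hfrac R a b" "(c, d) \<in> hfrac R c d"
    using assms by (auto simp: mem_hfrac_iff m_comm)
  note mem = this
  have L: "hfrac R a b \<uplus>\<^bsub>quotient_hyperfield R\<^esub> hfrac R c d =
      (\<Union>p \<in> hfrac R a b. \<Union>q \<in> hfrac R c d.
        {hfrac R x (snd p \<otimes> snd q) | x. x \<in> (fst p \<otimes> snd q) \<uplus> (snd p \<otimes> fst q)})"
    by (simp add: quotient_hyperfield_def case_prod_unfold)
  show ?thesis
  proof
    show "hfrac R a b \<uplus>\<^bsub>quotient_hyperfield R\<^esub> hfrac R c d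
        \<subseteq> {hfrac R x (b \<otimes> d) | x. x \<in> (a \<otimes> d) \<uplus> (b \<otimes> c)}"
      unfolding L
    proof (intro UN_least subsetI)
      fix p q z
      assume p: "p \<in> hfrac R a b" and q: "q \<in> hfrac R c d"
        and "z \<in> {hfrac R x (snd p \<otimes> snd q) | x. x \<in> (fst p \<otimes> snd q) \<uplus> (snd p \<otimes> fst q)}"
      then obtain x where x: "z = hfrac R x (snd p \<otimes> snd q)"
        "x \<in> (fst p \<otimes> snd q) \<uplus> (snd p \<otimes> fst q)" by blast
      show "z \<in> {hfrac R x (b \<otimes> d) | x. x \<in> (a \<otimes> d) \<uplus> (b \<otimes> c)}"
        unfolding x(1) using p q x(2) by (intro sub) simp_all
    qed
    show "{hfrac R x (b \<otimes> d) | x. x \<in> (a \<otimes> d) \<uplus> (b \<otimes> c)}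
        \<subseteq> hfrac R a b \<uplus>\<^bsub>quotient_hyperfield R\<^esub> hfrac R c d"
      unfolding L by (rule subsetI, rule UN_I[OF mem(1)], rule UN_I[OF mem(2)]) simp
  qed
qed

end

end

theory Submission
  imports Defs
begin

text \<open>
  The argument rests on one inequality for valuations. Let \<open>A\<close> be a hypervaluation hyperideal,
  \<open>A = J \<inter> R\<close> for a hyperideal \<open>J\<close> of the hypervaluation hyperring \<open>V\<close>. If \<open>x\<close> and \<open>z\<close> lie in
  \<open>R\<close> but not in \<open>A\<close>, then \<open>x z\<close> does not lie in the hyperideal \<open>A\<^sup>2\<close> generated by the products
  of two elements of \<open>A\<close> (lemma \<open>mult_notin_hsquare\<close>). Indeed, every \<open>a \<in> A\<close> is a multiple of
  \<open>x\<close> in \<open>V\<close>, since otherwise \<open>x \<in> a V \<subseteq> J\<close>. So all products \<open>a b\<close> lie in \<open>x J\<close>, while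
  \<open>x z \<in> x J\<close> would give \<open>z \<in> J\<close>.

  Since \<open>R\<close> is local, a proper hyperideal is \<open>M\<close>-primary as soon as its radical contains \<open>M\<close>.
  Hence \<open>\<Delta>\<close> is closed under binary intersections, under squares and under passing to larger
  proper hyperideals.

  For the total order let \<open>x \<in> A\<close>, \<open>x \<notin> B\<close>, \<open>y \<in> B\<close>, \<open>y \<notin> A\<close>, and put \<open>C = A \<inter> B\<close>. The
  hyperideal \<open>(x y) + C\<^sup>2\<close> belongs to \<open>\<Delta>\<close>, so it is a hypervaluation hyperideal. As one of
  \<open>x\<close>, \<open>y\<close> divides the other in the hypervaluation hyperring, it contains \<open>x\<^sup>2\<close> or \<open>y\<^sup>2\<close>; say
  \<open>x\<^sup>2 \<in> r x y + c\<close> with \<open>c \<in> C\<^sup>2\<close>. Then \<open>c = x z\<close> for some \<open>z \<in> x - r y\<close>. Here \<open>x \<notin> C\<close>, and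
  \<open>z \<notin> C\<close> because \<open>x \<notin> B\<close> and \<open>y \<in> B\<close>. This contradicts \<open>x z \<in> C\<^sup>2\<close>.

  For primality, if \<open>x\<close> and \<open>y\<close> are not in the intersection of \<open>\<Delta>\<close>, then some \<open>C \<in> \<Delta>\<close>
  contains neither of them, and \<open>x y \<notin> C\<^sup>2 \<in> \<Delta>\<close>.
\<close>


section \<open>Opposites and sums\<close>

context canonical_hypergroup
begin

lemma hopp_closed: "x \<in> carrier R \<Longrightarrow> hopp R x \<in> carrier R"
  and hzero_in_hadd_hopp: "x \<in> carrier R \<Longrightarrow> \<zero> \<in> x \<uplus> hopp R x"
  using theI'[OF hopp_unique] unfolding hopp_def by blast+

lemma hopp_eqI: "\<lbrakk>x \<in> carrier R; y \<in> carrier R; \<zero> \<in> x \<uplus> y\<rbrakk> \<Longrightarrow> hopp R x = y"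
  using hopp_unique hopp_closed hzero_in_hadd_hopp by blast

lemma hopp_hopp: "x \<in> carrier R \<Longrightarrow> hopp R (hopp R x) = x"
  by (metis hopp_eqI hopp_closed hzero_in_hadd_hopp hadd_comm)

lemma hadd_mem_closed: "\<lbrakk>x \<in> carrier R; y \<in> carrier R; z \<in> x \<uplus> y\<rbrakk> \<Longrightarrow> z \<in> carrier R"
  using hadd_closed by blast

lemma hadd_assoc_left:
  assumes "x \<in> carrier R" "y \<in> carrier R" "z \<in> carrier R" "u \<in> x \<uplus> y" "w \<in> u \<uplus> z"
  obtains v where "v \<in> y \<uplus> z" "w \<in> x \<uplus> v"
  using hadd_assoc[OF assms(1-3)] assms(4,5) by blast

lemma hadd_assoc_right:
  assumes "x \<in> carrier R" "y \<in> carrier R" "z \<in> carrier R" "v \<in> y \<uplus> z" "w \<in> x \<uplus> v"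
  obtains u where "u \<in> x \<uplus> y" "w \<in> u \<uplus> z"
  using hadd_assoc[OF assms(1-3)] assms(4,5) by blast

lemma hadd_interchange:
  assumes c: "u \<in> carrier R" "a \<in> carrier R" "u' \<in> carrier R" "a' \<in> carrier R"
    and t: "t \<in> u \<uplus> a" "s \<in> u' \<uplus> a'" "w \<in> t \<uplus> s"
  obtains p q where "p \<in> u \<uplus> u'" "q \<in> a \<uplus> a'" "w \<in> p \<uplus> q"
proof -
  have tc: "t \<in> carrier R" "s \<in> carrier R" using hadd_mem_closed c t by blast+
  obtain k where k: "k \<in> a \<uplus> s" "w \<in> u \<uplus> k"
    using hadd_assoc_left[OF c(1,2) tc(2) t(1,3)] .
  have s: "s \<in> a' \<uplus> u'" using t(2) hadd_comm c by simp
  obtain q where q: "q \<in> a \<uplus> a'" "k \<in> q \<uplus> u'"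
    using hadd_assoc_right[OF c(2,4,3) s k(1)] .
  have qc: "q \<in> carrier R" using hadd_mem_closed c q(1) by blast
  have k': "k \<in> u' \<uplus> q" using q(2) hadd_comm c qc by simp
  obtain p where "p \<in> u \<uplus> u'" "w \<in> p \<uplus> q"
    using hadd_assoc_right[OF c(1,3) qc k' k(2)] .
  then show ?thesis using q(1) that by blast
qed

lemma hopp_hadd:
  assumes c: "x \<in> carrier R" "y \<in> carrier R" and t: "t \<in> x \<uplus> y"
  shows "hopp R t \<in> hopp R x \<uplus> hopp R y"
proof -
  have tc: "t \<in> carrier R" using hadd_mem_closed c t by blast
  note oc = hopp_closed[OF c(1)] hopp_closed[OF c(2)] hopp_closed[OF tc]
  obtain v where v: "v \<in> y \<uplus> hopp R t" "\<zero> \<in> x \<uplus> v"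
    using hadd_assoc_left[OF c oc(3) t hzero_in_hadd_hopp[OF tc]] .
  have "v \<in> carrier R" using hadd_mem_closed c oc v(1) by blast
  then have "v = hopp R x" using hopp_eqI c v(2) by metis
  then have "hopp R t \<in> hopp R y \<uplus> hopp R x"
    using hadd_reversible[OF c(2) oc(3) v(1)] by simp
  then show ?thesis using hadd_comm oc by simp
qed

end


section \<open>Hyperideals of a Krasner hyperring\<close>

context krasner_hyperring
begin

lemma mult_hopp:
  assumes "a \<in> carrier R" "x \<in> carrier R"
  shows "hopp R (a \<otimes> x) = a \<otimes> hopp R x"
proof (rule hopp_eqI)
  have "a \<otimes> \<zero> \<in> (\<lambda>u. a \<otimes> u) ` (x \<uplus> hopp R x)"
    using hzero_in_hadd_hopp assms by blast
  then show "\<zero> \<in> (a \<otimes> x) \<uplus> (a \<otimes> hopp R x)"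
    using mult_hadd_distrib[of a x "hopp R x"] mult_hzero assms hopp_closed by simp
qed (use assms hopp_closed in auto)

lemma mult_hdiff:
  assumes "a \<in> carrier R" "x \<in> carrier R" "y \<in> carrier R"
  shows "hdiff R (a \<otimes> x) (a \<otimes> y) = (\<lambda>u. a \<otimes> u) ` hdiff R x y"
  using assms by (simp add: hdiff_def mult_hopp mult_hadd_distrib hopp_closed)

lemma hyperideal_mem_closed: "\<lbrakk>hyperideal R I; a \<in> I\<rbrakk> \<Longrightarrow> a \<in> carrier R"
  by (auto simp: hyperideal_def)

lemma hyperideal_hdiff: "\<lbrakk>hyperideal R I; a \<in> I; b \<in> I\<rbrakk> \<Longrightarrow> hdiff R a b \<subseteq> I"
  and hyperideal_mult_right: "\<lbrakk>hyperideal R I; a \<in> I; r \<in> carrier R\<rbrakk> \<Longrightarrow> a \<otimes> r \<in> I"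
  by (simp_all add: hyperideal_def)

lemma hyperideal_mult: "\<lbrakk>hyperideal R I; a \<in> I; r \<in> carrier R\<rbrakk> \<Longrightarrow> r \<otimes> a \<in> I"
  using m_comm by (auto simp: hyperideal_def)

lemma hyperideal_hzero: "hyperideal R I \<Longrightarrow> \<zero> \<in> I"
  using hzero_in_hadd_hopp unfolding hyperideal_def hdiff_def by blast

lemma hyperideal_hopp:
  assumes "hyperideal R I" "a \<in> I"
  shows "hopp R a \<in> I"
proof -
  have "hdiff R \<zero> a \<subseteq> I"
    using assms hyperideal_hzero by (auto simp: hyperideal_def)
  then show ?thesis
    using assms hyperideal_mem_closed by (simp add: hdiff_def hzero_hadd hopp_closed)
qed

lemma hyperideal_hadd:
  assumes "hyperideal R I" "a \<in> I" "b \<in> I" "t \<in> a \<uplus> b"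
  shows "t \<in> I"
proof -
  have "hdiff R a (hopp R b) \<subseteq> I"
    using assms hyperideal_hopp by (auto simp: hyperideal_def)
  then show ?thesis
    using assms hyperideal_mem_closed by (auto simp: hdiff_def hopp_hopp)
qed

lemma hyperideal_proper_iff: "hyperideal R I \<Longrightarrow> I \<noteq> carrier R \<longleftrightarrow> \<one> \<notin> I"
  using hyperideal_mult[of I \<one>] hyperideal_mem_closed by fastforce

lemma hyperideal_Inter:
  assumes "\<S> \<noteq> {}" "\<And>I. I \<in> \<S> \<Longrightarrow> hyperideal R I"
  shows "hyperideal R (\<Inter>\<S>)"
  unfolding hyperideal_def
proof (intro conjI ballI)
  show "\<Inter>\<S> \<noteq> {}" using assms hyperideal_hzero by blast
  show "\<Inter>\<S> \<subseteq> carrier R" using assms hyperideal_mem_closed by blast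
  show "hdiff R a b \<subseteq> \<Inter>\<S>" if "a \<in> \<Inter>\<S>" "b \<in> \<Inter>\<S>" for a b
    using that assms(2) hyperideal_hdiff by blast
  show "a \<otimes> r \<in> \<Inter>\<S>" if "a \<in> \<Inter>\<S>" "r \<in> carrier R" for a r
    using that assms(2) hyperideal_mult_right by blast
qed

lemma hyperideal_Int: "\<lbrakk>hyperideal R I; hyperideal R J\<rbrakk> \<Longrightarrow> hyperideal R (I \<inter> J)"
  using hyperideal_Inter[of "{I, J}"] by auto

lemma hyperideal_carrier: "hyperideal R (carrier R)"
  using hzero_closed hadd_closed hopp_closed by (auto simp: hyperideal_def hdiff_def)

lemma hyperideal_mult_image:
  assumes "hyperideal R I" "c \<in> carrier R"
  shows "hyperideal R ((\<lambda>u. c \<otimes> u) ` I)"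
  unfolding hyperideal_def
proof (intro conjI ballI)
  show "(\<lambda>u. c \<otimes> u) ` I \<noteq> {}" using assms by (auto simp: hyperideal_def)
  show "(\<lambda>u. c \<otimes> u) ` I \<subseteq> carrier R" using assms hyperideal_mem_closed by auto
next
  fix a b assume "a \<in> (\<lambda>u. c \<otimes> u) ` I" "b \<in> (\<lambda>u. c \<otimes> u) ` I"
  then obtain i j where ij: "i \<in> I" "a = c \<otimes> i" "j \<in> I" "b = c \<otimes> j" by blast
  then have "hdiff R a b = (\<lambda>u. c \<otimes> u) ` hdiff R i j"
    using mult_hdiff assms hyperideal_mem_closed by auto
  moreover have "hdiff R i j \<subseteq> I" using ij assms by (auto simp: hyperideal_def)
  ultimately show "hdiff R a b \<subseteq> (\<lambda>u. c \<otimes> u) ` I" by auto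
next
  fix a r assume "a \<in> (\<lambda>u. c \<otimes> u) ` I" and r: "r \<in> carrier R"
  then obtain i where i: "i \<in> I" "a = c \<otimes> i" by blast
  then have "a \<otimes> r = c \<otimes> (i \<otimes> r)"
    using assms r hyperideal_mem_closed by (simp add: m_assoc)
  moreover have "i \<otimes> r \<in> I" using i r assms by (auto simp: hyperideal_def)
  ultimately show "a \<otimes> r \<in> (\<lambda>u. c \<otimes> u) ` I" by blast
qed

lemma hyperideal_sum:
  assumes I: "hyperideal R I" and J: "hyperideal R J"
  shows "hyperideal R (\<Union>i \<in> I. \<Union>j \<in> J. i \<uplus> j)" (is "hyperideal R ?S")
  unfolding hyperideal_def
proof (intro conjI ballI)
  note cl = hyperideal_mem_closed[OF I] hyperideal_mem_closed[OF J]
  have "\<zero> \<in> \<zero> \<uplus> \<zero>" using hzero_hadd hzero_closed by simp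
  then show "?S \<noteq> {}" using hyperideal_hzero I J by blast
  show "?S \<subseteq> carrier R" using cl hadd_mem_closed by blast
  show "hdiff R t s \<subseteq> ?S" if ts: "t \<in> ?S" "s \<in> ?S" for t s
  proof
    fix w assume w: "w \<in> hdiff R t s"
    obtain i j i' j' where ij: "i \<in> I" "j \<in> J" "t \<in> i \<uplus> j" "i' \<in> I" "j' \<in> J" "s \<in> i' \<uplus> j'"
      using ts by blast
    have s: "hopp R s \<in> hopp R i' \<uplus> hopp R j'" using hopp_hadd cl ij by blast
    obtain p q where "p \<in> i \<uplus> hopp R i'" "q \<in> j \<uplus> hopp R j'" "w \<in> p \<uplus> q"
      using hadd_interchange[OF _ _ _ _ ij(3) s] w cl ij hopp_closed unfolding hdiff_def
      by metis
    moreover from this have "p \<in> I" "q \<in> J"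
      using ij hyperideal_hadd hyperideal_hopp I J by blast+
    ultimately show "w \<in> ?S" by blast
  qed
  show "t \<otimes> r \<in> ?S" if t: "t \<in> ?S" and r: "r \<in> carrier R" for t r
  proof -
    obtain i j where ij: "i \<in> I" "j \<in> J" "t \<in> i \<uplus> j" using t by blast
    then have "r \<otimes> t \<in> (r \<otimes> i) \<uplus> (r \<otimes> j)"
      using mult_hadd_distrib[of r i j] r cl by blast
    moreover have "t \<in> carrier R" using hadd_mem_closed cl ij by blast
    moreover have "r \<otimes> i \<in> I" "r \<otimes> j \<in> J" using hyperideal_mult I J ij r by blast+
    ultimately show ?thesis using m_comm[of t r] r by auto
  qed
qed

text \<open>The square of a set \<open>A\<close>: the least hyperideal containing all products of two elements of
  \<open>A\<close>. Taking an intersection avoids finite hypersums.\<close>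

definition hsquare :: "'a set \<Rightarrow> 'a set" where
  "hsquare A = \<Inter>{B. hyperideal R B \<and> (\<forall>a \<in> A. \<forall>b \<in> A. a \<otimes> b \<in> B)}"

lemma hyperideal_hsquare:
  assumes "A \<subseteq> carrier R"
  shows "hyperideal R (hsquare A)"
  unfolding hsquare_def
proof (rule hyperideal_Inter)
  show "{B. hyperideal R B \<and> (\<forall>a \<in> A. \<forall>b \<in> A. a \<otimes> b \<in> B)} \<noteq> {}"
    using hyperideal_carrier assms by blast
qed blast

lemma mult_in_hsquare: "\<lbrakk>a \<in> A; b \<in> A\<rbrakk> \<Longrightarrow> a \<otimes> b \<in> hsquare A"
  by (auto simp: hsquare_def)

lemma hsquare_least:
  "\<lbrakk>hyperideal R B; \<And>a b. \<lbrakk>a \<in> A; b \<in> A\<rbrakk> \<Longrightarrow> a \<otimes> b \<in> B\<rbrakk> \<Longrightarrow> hsquare A \<subseteq> B"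
  by (auto simp: hsquare_def)

lemma hsquare_subset: "hyperideal R A \<Longrightarrow> hsquare A \<subseteq> A"
  using hsquare_least hyperideal_mult hyperideal_mem_closed by metis


section \<open>Primary hyperideals of a local hyperring\<close>

lemma proper_hyperideal_in_maximal:
  assumes I: "hyperideal R I" "I \<noteq> carrier R"
  obtains N where "maximal_hyperideal R N" "I \<subseteq> N"
proof -
  define \<S> where "\<S> = {J. hyperideal R J \<and> \<one> \<notin> J \<and> I \<subseteq> J}"
  have "\<exists>N \<in> \<S>. \<forall>J \<in> \<S>. N \<subseteq> J \<longrightarrow> J = N"
  proof (rule subset_Zorn_nonempty)
    show "\<S> \<noteq> {}" using I hyperideal_proper_iff by (auto simp: \<S>_def)
  next
    fix \<C> assume ne: "\<C> \<noteq> {}" and ch: "subset.chain \<S> \<C>"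
    then have sub: "\<C> \<subseteq> \<S>" and lin: "\<And>A B. \<lbrakk>A \<in> \<C>; B \<in> \<C>\<rbrakk> \<Longrightarrow> A \<subseteq> B \<or> B \<subseteq> A"
      by (auto simp: subset_chain_def)
    have id: "hyperideal R A" if "A \<in> \<C>" for A using that sub by (auto simp: \<S>_def)
    have "hyperideal R (\<Union>\<C>)"
      unfolding hyperideal_def
    proof (intro conjI ballI)
      show "\<Union>\<C> \<noteq> {}" using ne id hyperideal_hzero by blast
      show "\<Union>\<C> \<subseteq> carrier R" using id hyperideal_mem_closed by blast
      show "hdiff R a b \<subseteq> \<Union>\<C>" if ab: "a \<in> \<Union>\<C>" "b \<in> \<Union>\<C>" for a b
      proof -
        obtain A where "A \<in> \<C>" "a \<in> A" "b \<in> A" using ab lin by blast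
        then show ?thesis using hyperideal_hdiff[OF id] by blast
      qed
      show "a \<otimes> r \<in> \<Union>\<C>" if "a \<in> \<Union>\<C>" "r \<in> carrier R" for a r
        using that hyperideal_mult_right[OF id] by blast
    qed
    then show "\<Union>\<C> \<in> \<S>" using sub ne by (auto simp: \<S>_def)
  qed
  then obtain N where N: "N \<in> \<S>" "\<And>J. \<lbrakk>J \<in> \<S>; N \<subseteq> J\<rbrakk> \<Longrightarrow> J = N" by blast
  have "maximal_hyperideal R N"
    unfolding maximal_hyperideal_def
  proof (intro conjI allI impI)
    show "hyperideal R N" "N \<noteq> carrier R"
      using N(1) hyperideal_proper_iff by (auto simp: \<S>_def)
    show "J = N \<or> J = carrier R" if J: "hyperideal R J \<and> N \<subseteq> J" for J
    proof (cases "\<one> \<in> J")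
      case True then show ?thesis using hyperideal_proper_iff J by blast
    next
      case False
      then have "J \<in> \<S>" using N(1) J by (auto simp: \<S>_def)
      then show ?thesis using N(2) J by blast
    qed
  qed
  then show ?thesis using that N(1) by (auto simp: \<S>_def)
qed

lemma local_hyperring_Units:
  assumes "local_hyperring R" "maximal_hyperideal R M" "r \<in> carrier R" "r \<notin> M"
  shows "r \<in> Units R"
proof (rule ccontr)
  assume nu: "r \<notin> Units R"
  let ?P = "(\<lambda>u. r \<otimes> u) ` carrier R"
  have P: "hyperideal R ?P" using hyperideal_mult_image hyperideal_carrier assms(3) .
  moreover have "\<one> \<notin> ?P" using nu assms(3) m_comm by (force simp: Units_def)
  ultimately obtain N where N: "maximal_hyperideal R N" "?P \<subseteq> N"
    using proper_hyperideal_in_maximal hyperideal_proper_iff by metis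
  have "N = M" using N(1) assms(1,2) unfolding local_hyperring_def by blast
  moreover have "r \<in> ?P" using assms(3) by (force intro: image_eqI[of _ _ \<one>])
  ultimately show False using N(2) assms(4) by blast
qed

lemma hradical_mono: "Q \<subseteq> Q' \<Longrightarrow> hradical R Q \<subseteq> hradical R Q'"
  by (auto simp: hradical_def)

text \<open>Over a local hyperring being \<open>M\<close>-primary only depends on the radical being large, because
  all elements outside \<open>M\<close> are units.\<close>

lemma primary_hyperideal_ofI:
  assumes loc: "local_hyperring R" "maximal_hyperideal R M"
    and Q: "hyperideal R Q" "\<one> \<notin> Q" and M: "M \<subseteq> hradical R Q"
  shows "primary_hyperideal_of R M Q"
  unfolding primary_hyperideal_of_def primary_hyperideal_def
proof (intro conjI ballI impI)
  show "hyperideal R Q" "Q \<noteq> carrier R" using Q hyperideal_proper_iff by auto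
next
  fix x y assume xy: "x \<in> carrier R" "y \<in> carrier R" "x \<otimes> y \<in> Q"
  show "x \<in> Q \<or> y \<in> hradical R Q"
  proof (cases "y \<in> M")
    case False
    then have y: "y \<in> Units R" using local_hyperring_Units loc xy by blast
    then have "inv y \<otimes> (x \<otimes> y) \<in> Q" using hyperideal_mult Q xy by auto
    moreover have "inv y \<otimes> (x \<otimes> y) = x" using xy y by (simp add: m_lcomm)
    ultimately show ?thesis by simp
  qed (use M in blast)
next
  have "x \<in> M" if x: "x \<in> hradical R Q" for x
  proof (rule ccontr)
    assume "x \<notin> M"
    obtain n :: nat where n: "x \<in> carrier R" "x [^] n \<in> Q"
      using x by (auto simp: hradical_def)
    have "x [^] n \<in> Units R"
      using local_hyperring_Units[OF loc n(1) \<open>x \<notin> M\<close>] by (induction n) auto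
    then have "inv (x [^] n) \<otimes> x [^] n = \<one>" "inv (x [^] n) \<in> carrier R"
      by (rule Units_l_inv, rule Units_inv_closed)
    then have "\<one> \<in> Q" using hyperideal_mult[OF Q(1) n(2)] by metis
    then show False using Q(2) by simp
  qed
  then show "hradical R Q = M" using M by blast
qed

lemma primary_hyperideal_ofD:
  assumes "primary_hyperideal_of R M Q"
  shows "hyperideal R Q" "\<one> \<notin> Q" "M = hradical R Q" "Q \<subseteq> M"
proof -
  show Q: "hyperideal R Q" and "\<one> \<notin> Q" and M: "M = hradical R Q"
    using assms hyperideal_proper_iff
    by (auto simp: primary_hyperideal_of_def primary_hyperideal_def)
  have "x [^] (1::nat) \<in> Q" if "x \<in> Q" for x
    using that Q hyperideal_mem_closed by simp
  then show "Q \<subseteq> M"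
    unfolding M hradical_def using Q hyperideal_mem_closed zero_less_one by blast
qed

lemma primary_hyperideal_of_maximal:
  assumes loc: "local_hyperring R" "maximal_hyperideal R M"
  shows "primary_hyperideal_of R M M"
proof (rule primary_hyperideal_ofI[OF loc])
  show M: "hyperideal R M" and "\<one> \<notin> M"
    using loc(2) hyperideal_proper_iff by (auto simp: maximal_hyperideal_def)
  have "x [^] (1::nat) \<in> M" if "x \<in> M" for x
    using that M hyperideal_mem_closed by simp
  then show "M \<subseteq> hradical R M"
    unfolding hradical_def using M hyperideal_mem_closed zero_less_one by blast
qed

lemma primary_hyperideal_of_superset:
  assumes loc: "local_hyperring R" "maximal_hyperideal R M"
    and "primary_hyperideal_of R M Q" "Q \<subseteq> Q'" "hyperideal R Q'" "\<one> \<notin> Q'"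
  shows "primary_hyperideal_of R M Q'"
  using primary_hyperideal_ofI[OF loc] primary_hyperideal_ofD(3)[OF assms(3)]
    hradical_mono assms by simp

lemma primary_hyperideal_of_Int:
  assumes loc: "local_hyperring R" "maximal_hyperideal R M"
    and A: "primary_hyperideal_of R M A" and B: "primary_hyperideal_of R M B"
  shows "primary_hyperideal_of R M (A \<inter> B)"
proof (rule primary_hyperideal_ofI[OF loc])
  note D = primary_hyperideal_ofD[OF A] primary_hyperideal_ofD[OF B]
  show "hyperideal R (A \<inter> B)" "\<one> \<notin> A \<inter> B" using D hyperideal_Int by auto
  show "M \<subseteq> hradical R (A \<inter> B)"
  proof
    fix x assume "x \<in> M"
    then have "x \<in> hradical R A" "x \<in> hradical R B" using D by auto
    then obtain m n :: nat where mn: "x \<in> carrier R" "m > 0" "x [^] m \<in> A" "x [^] n \<in> B"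
      by (auto simp: hradical_def)
    have "x [^] n \<otimes> x [^] m \<in> A" "x [^] m \<otimes> x [^] n \<in> B"
      using mn D hyperideal_mult by auto
    then have "x [^] (m + n) \<in> A \<inter> B"
      using mn(1) by (simp add: nat_pow_mult add.commute)
    then show "x \<in> hradical R (A \<inter> B)"
      using mn(1,2) unfolding hradical_def by (blast intro: add_pos_nonneg)
  qed
qed

lemma primary_hyperideal_of_hsquare:
  assumes loc: "local_hyperring R" "maximal_hyperideal R M"
    and A: "primary_hyperideal_of R M A"
  shows "primary_hyperideal_of R M (hsquare A)"
proof (rule primary_hyperideal_ofI[OF loc])
  note D = primary_hyperideal_ofD[OF A]
  show "hyperideal R (hsquare A)" using hyperideal_hsquare D(1) by (auto simp: hyperideal_def)
  show "\<one> \<notin> hsquare A" using hsquare_subset D by blast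
  show "M \<subseteq> hradical R (hsquare A)"
  proof
    fix x assume "x \<in> M"
    then have "x \<in> hradical R A" using D by auto
    then obtain n :: nat where n: "x \<in> carrier R" "n > 0" "x [^] n \<in> A"
      by (auto simp: hradical_def)
    have "x [^] (n + n) \<in> hsquare A"
      using mult_in_hsquare[OF n(3,3)] n(1) by (simp add: nat_pow_mult)
    then show "x \<in> hradical R (hsquare A)"
      using n(1,2) unfolding hradical_def by (blast intro: add_pos_pos)
  qed
qed

end


section \<open>Hypervaluation hyperideals\<close>

context krasner_hyperdomain
begin

text \<open>The degenerate case \<open>\<one> = \<zero>\<close> has to be excluded before \<open>hembed\<close> can be computed with.\<close>

lemma one_nonzero:
  assumes "hyperideal R I" "x \<in> carrier R" "x \<notin> I"
  shows "\<one> \<noteq> \<zero>"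
  using assms hyperideal_hzero mult_hzero by (metis r_one)

lemma hembed_mult:
  assumes "\<one> \<noteq> \<zero>" "a \<in> carrier R" "b \<in> carrier R"
  shows "hembed R a \<otimes>\<^bsub>quotient_hyperfield R\<^esub> hembed R b = hembed R (a \<otimes> b)"
  using assms by (simp add: hembed_def quotient_hyperfield_mult)

lemma hembed_hadd:
  assumes "\<one> \<noteq> \<zero>" "a \<in> carrier R" "b \<in> carrier R"
  shows "hembed R a \<uplus>\<^bsub>quotient_hyperfield R\<^esub> hembed R b = hembed R ` (a \<uplus> b)"
  using assms by (auto simp: hembed_def quotient_hyperfield_hadd)

lemma hembed_hzero: "hembed R \<zero> = \<zero>\<^bsub>quotient_hyperfield R\<^esub>"
  by (simp add: hembed_def quotient_hyperfield_def)

lemma hfrac_mult_hembed: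
  assumes "\<one> \<noteq> \<zero>" "a \<in> carrier R" "b \<in> carrier R - {\<zero>}"
  shows "hfrac R a b \<otimes>\<^bsub>quotient_hyperfield R\<^esub> hembed R b = hembed R a"
  using assms hfrac_eq_iff[of "a \<otimes> b" b a \<one>]
  by (simp add: hembed_def quotient_hyperfield_mult m_comm)

lemma inv_hfrac:
  assumes "\<one> \<noteq> \<zero>" "a \<in> carrier R - {\<zero>}" "b \<in> carrier R - {\<zero>}"
  shows "inv\<^bsub>quotient_hyperfield R\<^esub> hfrac R a b = hfrac R b a"
proof -
  let ?Q = "quotient_hyperfield R"
  have one: "\<one>\<^bsub>?Q\<^esub> = hfrac R \<one> \<one>" by (simp add: quotient_hyperfield_def)
  have one_iff: "hfrac R c d \<otimes>\<^bsub>?Q\<^esub> hfrac R e f = \<one>\<^bsub>?Q\<^esub> \<longleftrightarrow> c \<otimes> e = d \<otimes> f"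
    if "c \<in> carrier R" "d \<in> carrier R - {\<zero>}" "e \<in> carrier R" "f \<in> carrier R - {\<zero>}" for c d e f
    using that assms(1) mult_nonzero[OF that(2,4)] unfolding one
    by (simp add: quotient_hyperfield_mult hfrac_eq_iff)
  show ?thesis
    unfolding m_inv_def
  proof (rule the_equality)
    show "hfrac R b a \<in> carrier ?Q \<and> hfrac R a b \<otimes>\<^bsub>?Q\<^esub> hfrac R b a = \<one>\<^bsub>?Q\<^esub> \<and>
        hfrac R b a \<otimes>\<^bsub>?Q\<^esub> hfrac R a b = \<one>\<^bsub>?Q\<^esub>"
      using assms one_iff by (auto simp: quotient_hyperfield_def m_comm)
  next
    fix Y assume Y: "Y \<in> carrier ?Q \<and> hfrac R a b \<otimes>\<^bsub>?Q\<^esub> Y = \<one>\<^bsub>?Q\<^esub> \<and>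
        Y \<otimes>\<^bsub>?Q\<^esub> hfrac R a b = \<one>\<^bsub>?Q\<^esub>"
    then obtain c d where cd: "c \<in> carrier R" "d \<in> carrier R - {\<zero>}" "Y = hfrac R c d"
      by (auto simp: quotient_hyperfield_def)
    then have "a \<otimes> c = b \<otimes> d" using Y one_iff[of a b c d] assms by simp
    then show "Y = hfrac R b a"
      using cd assms hfrac_eq_iff[of c d b a] by (simp add: m_comm)
  qed
qed

lemma hypervaluation_hyperring_krasner:
  "hypervaluation_hyperring R V \<Longrightarrow> krasner_hyperring ((quotient_hyperfield R)\<lparr>carrier := V\<rparr>)"
  by (simp add: hypervaluation_hyperring_def subhyperring_def)

text \<open>Of two elements of \<open>R\<close>, one divides the other in the hypervaluation hyperring.\<close>

lemma hypervaluation_dvd: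
  assumes ne: "\<one> \<noteq> \<zero>" and V: "hypervaluation_hyperring R V" "hembed R ` carrier R \<subseteq> V"
    and ab: "a \<in> carrier R" "b \<in> carrier R"
  shows "(\<exists>v \<in> V. hembed R a = v \<otimes>\<^bsub>quotient_hyperfield R\<^esub> hembed R b) \<or>
    (\<exists>v \<in> V. hembed R b = v \<otimes>\<^bsub>quotient_hyperfield R\<^esub> hembed R a)"
proof -
  let ?Q = "quotient_hyperfield R"
  have z: "hembed R \<zero> \<in> V" "hembed R \<zero> = hembed R \<zero> \<otimes>\<^bsub>?Q\<^esub> hembed R c" if "c \<in> carrier R" for c
    using that V(2) ne hzero_closed by (auto simp: hembed_mult m_comm[of \<zero>] mult_hzero)
  show ?thesis
  proof (cases "a = \<zero> \<or> b = \<zero>")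
    case True
    then show ?thesis using z ab by blast
  next
    case False
    then have nz: "a \<in> carrier R - {\<zero>}" "b \<in> carrier R - {\<zero>}" using ab by auto
    have "hfrac R a b \<in> carrier ?Q" using ab nz by (auto simp: quotient_hyperfield_def)
    moreover have "hfrac R a b \<noteq> \<zero>\<^bsub>?Q\<^esub>"
      using hfrac_eq_iff[of a b \<zero> \<one>] nz ne hzero_closed
      by (simp add: quotient_hyperfield_def mult_hzero)
    ultimately have "hfrac R a b \<in> V \<or> hfrac R b a \<in> V"
      using V(1) inv_hfrac[OF ne nz] unfolding hypervaluation_hyperring_def by force
    then show ?thesis using hfrac_mult_hembed ne nz ab by metis
  qed
qed

lemma hyperideal_contraction:
  assumes ne: "\<one> \<noteq> \<zero>" and V: "hypervaluation_hyperring R V" "hembed R ` carrier R \<subseteq> V"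
    and J: "hyperideal ((quotient_hyperfield R)\<lparr>carrier := V\<rparr>) J"
  shows "hyperideal R {a \<in> carrier R. hembed R a \<in> J}"
proof -
  let ?V = "(quotient_hyperfield R)\<lparr>carrier := V\<rparr>"
  interpret V: krasner_hyperring ?V using hypervaluation_hyperring_krasner V(1) .
  have in_V: "hembed R a \<in> V" if "a \<in> carrier R" for a using V(2) that by blast
  have opp: "hopp ?V (hembed R b) = hembed R (hopp R b)" if b: "b \<in> carrier R" for b
  proof (rule V.hopp_eqI)
    show "\<zero>\<^bsub>?V\<^esub> \<in> hembed R b \<uplus>\<^bsub>?V\<^esub> hembed R (hopp R b)"
      using hembed_hadd[OF ne b hopp_closed[OF b]] hzero_in_hadd_hopp[OF b]
      by (simp flip: hembed_hzero)
  qed (use in_V b hopp_closed in auto)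
  have diff: "hembed R ` hdiff R a b = hdiff ?V (hembed R a) (hembed R b)"
    if "a \<in> carrier R" "b \<in> carrier R" for a b
    using that by (simp add: hdiff_def opp hembed_hadd[OF ne] hopp_closed)
  show ?thesis
    unfolding hyperideal_def
  proof (intro conjI ballI)
    show "{a \<in> carrier R. hembed R a \<in> J} \<noteq> {}"
      using V.hyperideal_hzero[OF J] hzero_closed by (auto simp flip: hembed_hzero)
  next
    fix a b assume ab: "a \<in> {a \<in> carrier R. hembed R a \<in> J}" "b \<in> {a \<in> carrier R. hembed R a \<in> J}"
    then have "hembed R ` hdiff R a b \<subseteq> J"
      using J by (simp add: diff hyperideal_def)
    moreover have "hdiff R a b \<subseteq> carrier R"
      using ab hadd_closed hopp_closed by (simp add: hdiff_def)
    ultimately show "hdiff R a b \<subseteq> {a \<in> carrier R. hembed R a \<in> J}" by blast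
  next
    fix a r assume a: "a \<in> {a \<in> carrier R. hembed R a \<in> J}" and r: "r \<in> carrier R"
    then have "hembed R a \<otimes>\<^bsub>?V\<^esub> hembed R r \<in> J"
      using J in_V[OF r] by (simp add: hyperideal_def)
    then show "a \<otimes> r \<in> {a \<in> carrier R. hembed R a \<in> J}"
      using a r hembed_mult[OF ne] by simp
  qed blast
qed

lemma square_in_hypervaluation_hyperideal:
  assumes "hypervaluation_hyperideal R I"
    and xy: "x \<in> carrier R" "y \<in> carrier R" "x \<otimes> y \<in> I"
  shows "x \<otimes> x \<in> I \<or> y \<otimes> y \<in> I"
proof (cases "x \<otimes> x \<in> I")
  case False
  let ?Q = "quotient_hyperfield R"
  obtain V J where I: "hyperideal R I" and V: "hypervaluation_hyperring R V"
    "hembed R ` carrier R \<subseteq> V" and J: "hyperideal (?Q\<lparr>carrier := V\<rparr>) J"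
    and IJ: "I = {a \<in> carrier R. hembed R a \<in> J}"
    using assms(1) unfolding hypervaluation_hyperideal_def by blast
  interpret V: krasner_hyperring "?Q\<lparr>carrier := V\<rparr>"
    using hypervaluation_hyperring_krasner V(1) .
  have ne: "\<one> \<noteq> \<zero>" using one_nonzero I False xy by blast
  have main: "a \<otimes> a \<in> I"
    if ab: "a \<in> carrier R" "b \<in> carrier R" "a \<otimes> b \<in> I"
      and v: "v \<in> V" "hembed R a = v \<otimes>\<^bsub>?Q\<^esub> hembed R b" for a b v
  proof -
    have c: "hembed R a \<in> V" "hembed R b \<in> V" using V(2) ab by auto
    have "hembed R (a \<otimes> a) = (v \<otimes>\<^bsub>?Q\<^esub> hembed R b) \<otimes>\<^bsub>?Q\<^esub> hembed R a"
      using hembed_mult[OF ne ab(1,1)] by (simp flip: v(2))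
    also have "\<dots> = v \<otimes>\<^bsub>?Q\<^esub> hembed R (a \<otimes> b)"
      using V.m_assoc[of v "hembed R b" "hembed R a"] v(1) c ab hembed_mult[OF ne]
      by (simp add: m_comm)
    also have "\<dots> \<in> J"
      using V.hyperideal_mult[OF J, of "hembed R (a \<otimes> b)" v] v(1) ab(3) IJ by simp
    finally show ?thesis using ab IJ by simp
  qed
  show ?thesis
    using hypervaluation_dvd[OF ne V xy(1,2)]
  proof (elim disjE bexE)
    fix v assume "v \<in> V" "hembed R x = v \<otimes>\<^bsub>?Q\<^esub> hembed R y"
    then show ?thesis using main xy by blast
  next
    fix v assume "v \<in> V" "hembed R y = v \<otimes>\<^bsub>?Q\<^esub> hembed R x"
    moreover have "y \<otimes> x \<in> I" using xy by (simp add: m_comm)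
    ultimately show ?thesis using main xy by blast
  qed
qed simp

lemma mult_notin_hsquare:
  assumes "hypervaluation_hyperideal R A"
    and xz: "x \<in> carrier R - A" "z \<in> carrier R - A"
  shows "x \<otimes> z \<notin> hsquare A"
proof -
  let ?Q = "quotient_hyperfield R"
  obtain V J where A: "hyperideal R A" and V: "hypervaluation_hyperring R V"
    "hembed R ` carrier R \<subseteq> V" and J: "hyperideal (?Q\<lparr>carrier := V\<rparr>) J"
    and AJ: "A = {a \<in> carrier R. hembed R a \<in> J}"
    using assms(1) unfolding hypervaluation_hyperideal_def by blast
  interpret V: krasner_hyperring "?Q\<lparr>carrier := V\<rparr>"
    using hypervaluation_hyperring_krasner V(1) .
  have ne: "\<one> \<noteq> \<zero>" using one_nonzero A xz by blast
  have in_V: "hembed R a \<in> V" if "a \<in> carrier R" for a using V(2) that by blast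
  \<comment> \<open>\<open>K = x J\<close> contains all products of two elements of \<open>A\<close>, but not \<open>x z\<close>.\<close>
  define K where "K = (\<lambda>u. hembed R x \<otimes>\<^bsub>?Q\<^esub> u) ` J"
  have K: "hyperideal (?Q\<lparr>carrier := V\<rparr>) K"
    using V.hyperideal_mult_image[OF J, of "hembed R x"] in_V xz by (simp add: K_def)
  have "hsquare A \<subseteq> {a \<in> carrier R. hembed R a \<in> K}"
  proof (rule hsquare_least)
    show "hyperideal R {a \<in> carrier R. hembed R a \<in> K}"
      using hyperideal_contraction ne V K .
  next
    fix a b assume ab: "a \<in> A" "b \<in> A"
    have c: "a \<in> carrier R" "b \<in> carrier R" "x \<in> carrier R"
      using ab xz hyperideal_mem_closed A by auto
    have "hembed R x \<notin> J" using AJ xz by simp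
    then have "\<not> (\<exists>v \<in> V. hembed R x = v \<otimes>\<^bsub>?Q\<^esub> hembed R a)"
      using V.hyperideal_mult[OF J] ab(1) AJ by auto
    then obtain v where v: "v \<in> V" "hembed R a = v \<otimes>\<^bsub>?Q\<^esub> hembed R x"
      using hypervaluation_dvd[OF ne V c(1,3)] by blast
    have "hembed R (a \<otimes> b) = (v \<otimes>\<^bsub>?Q\<^esub> hembed R x) \<otimes>\<^bsub>?Q\<^esub> hembed R b"
      using c hembed_mult[OF ne] v(2) by metis
    also have "\<dots> = hembed R x \<otimes>\<^bsub>?Q\<^esub> (v \<otimes>\<^bsub>?Q\<^esub> hembed R b)"
      using V.m_assoc[of "hembed R x" v "hembed R b"] V.m_comm[of v "hembed R x"] v(1) in_V c
      by simp
    also have "\<dots> \<in> K"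
      using V.hyperideal_mult[OF J, of "hembed R b" v] v(1) ab(2) AJ by (simp add: K_def)
    finally show "a \<otimes> b \<in> {a \<in> carrier R. hembed R a \<in> K}" using c by simp
  qed
  moreover have "hembed R (x \<otimes> z) \<notin> K"
  proof
    assume "hembed R (x \<otimes> z) \<in> K"
    then obtain j where j: "j \<in> J" "hembed R x \<otimes>\<^bsub>?Q\<^esub> hembed R z = hembed R x \<otimes>\<^bsub>?Q\<^esub> j"
      using hembed_mult[OF ne] xz by (auto simp: K_def)
    have "j \<in> carrier ?Q"
      using V.hyperideal_mem_closed[OF J j(1)] V(1)
      by (auto simp: hypervaluation_hyperring_def subhyperring_def)
    then obtain c d where cd: "j = hfrac R c d" "c \<in> carrier R" "d \<in> carrier R - {\<zero>}"
      by (auto simp: quotient_hyperfield_def)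
    have x: "x \<in> carrier R - {\<zero>}" using xz hyperideal_hzero A by blast
    have "hfrac R (x \<otimes> z) \<one> = hfrac R (x \<otimes> c) d"
      using j(2) cd ne x xz by (simp add: hembed_def quotient_hyperfield_mult)
    then have "x \<otimes> (z \<otimes> d) = x \<otimes> c"
      using hfrac_eq_iff[of "x \<otimes> z" \<one> "x \<otimes> c" d] cd ne x xz by (simp add: m_assoc)
    then have "z \<otimes> d = c" using mult_left_cancel[OF x] cd xz by simp
    then have "hembed R z = j"
      using hfrac_eq_iff[of z \<one> c d] cd ne xz by (simp add: hembed_def)
    then show False using j(1) AJ xz by simp
  qed
  ultimately show ?thesis by blast
qed


section \<open>Local hyperdomains whose primary hyperideals are hypervaluation hyperideals\<close>

text \<open>The hyperideal on the right is \<open>(x y) + (A \<inter> B)\<^sup>2\<close>. If also \<open>y \<notin> A\<close>, exchanging \<open>A\<close> and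
  \<open>B\<close> excludes \<open>y\<^sup>2\<close> from it as well.\<close>

lemma square_notin_hypervaluation_sum:
  assumes A: "hyperideal R A" and B: "hyperideal R B"
    and C: "hypervaluation_hyperideal R (A \<inter> B)"
    and x: "x \<in> A - B" and y: "y \<in> B"
  shows "x \<otimes> x \<notin> (\<Union>i \<in> (\<lambda>u. (x \<otimes> y) \<otimes> u) ` carrier R. \<Union>j \<in> hsquare (A \<inter> B). i \<uplus> j)"
proof
  assume "x \<otimes> x \<in> (\<Union>i \<in> (\<lambda>u. (x \<otimes> y) \<otimes> u) ` carrier R. \<Union>j \<in> hsquare (A \<inter> B). i \<uplus> j)"
  then obtain r c where r: "r \<in> carrier R" and c: "c \<in> hsquare (A \<inter> B)"
    and xx: "x \<otimes> x \<in> ((x \<otimes> y) \<otimes> r) \<uplus> c" by blast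
  have cl: "x \<in> carrier R" "y \<in> carrier R" "y \<otimes> r \<in> carrier R" "y \<otimes> r \<in> B"
    using x y r A B hyperideal_mem_closed by (auto simp: hyperideal_def)
  have "hyperideal R (hsquare (A \<inter> B))"
    using hyperideal_hsquare A hyperideal_mem_closed by blast
  then have "c \<in> carrier R" using c hyperideal_mem_closed by blast
  then have "c \<in> hopp R ((x \<otimes> y) \<otimes> r) \<uplus> (x \<otimes> x)"
    using hadd_reversible xx cl r by simp
  also have "hopp R ((x \<otimes> y) \<otimes> r) \<uplus> (x \<otimes> x) = (\<lambda>u. x \<otimes> u) ` (hopp R (y \<otimes> r) \<uplus> x)"
    using cl r by (simp add: m_assoc mult_hopp mult_hadd_distrib hopp_closed)
  finally obtain z where z: "z \<in> hopp R (y \<otimes> r) \<uplus> x" "c = x \<otimes> z" by blast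
  have zc: "z \<in> carrier R" using z(1) cl hopp_closed hadd_mem_closed by blast
  have "z \<notin> B"
  proof
    assume "z \<in> B"
    have "x \<in> (y \<otimes> r) \<uplus> z"
      using hadd_reversible[OF hopp_closed[OF cl(3)] cl(1) z(1)] hopp_hopp[OF cl(3)] by simp
    then show False using hyperideal_hadd[OF B cl(4) \<open>z \<in> B\<close>] x by blast
  qed
  then have "x \<otimes> z \<notin> hsquare (A \<inter> B)"
    using mult_notin_hsquare[OF C] x cl zc by blast
  then show False using c z(2) by simp
qed

end

theorem theorem4p10:
  fixes R :: "('a, 'b) hyperring_scheme"
    and M :: "'a set" and \<Delta> \<Theta> :: "'a set set"
  assumes "krasner_hyperdomain R"
    and "local_hyperring R"
    and "maximal_hyperideal R M"
    and "\<Delta> = {Q. primary_hyperideal_of R M Q}"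
    and "\<forall>Q \<in> \<Delta>. normal_hyperideal R Q"
    and "\<Theta> = {I. hypervaluation_hyperideal R I}"
    and "\<Delta> \<subseteq> \<Theta>"
  shows "(\<forall>A \<in> \<Delta>. \<forall>B \<in> \<Delta>. A \<subseteq> B \<or> B \<subseteq> A) \<and> prime_hyperideal R (\<Inter>Q \<in> \<Delta>. Q)"
proof -
  interpret krasner_hyperdomain R by fact
  note loc = assms(2,3)
  have \<Delta>: "Q \<in> \<Delta> \<longleftrightarrow> primary_hyperideal_of R M Q" for Q using assms(4) by simp
  have val: "hypervaluation_hyperideal R Q" if "Q \<in> \<Delta>" for Q using assms(6,7) that by blast
  have id: "hyperideal R Q" "\<one>\<^bsub>R\<^esub> \<notin> Q" "Q \<subseteq> M" if "Q \<in> \<Delta>" for Q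
    using primary_hyperideal_ofD that \<Delta> by blast+
  have Int: "A \<inter> B \<in> \<Delta>" if "A \<in> \<Delta>" "B \<in> \<Delta>" for A B
    using primary_hyperideal_of_Int loc that \<Delta> by blast
  have sq: "hsquare A \<in> \<Delta>" if "A \<in> \<Delta>" for A
    using primary_hyperideal_of_hsquare loc that \<Delta> by blast
  have "M \<in> \<Delta>" using primary_hyperideal_of_maximal loc \<Delta> by blast
  have "A \<subseteq> B \<or> B \<subseteq> A" if AB: "A \<in> \<Delta>" "B \<in> \<Delta>" for A B
  proof (rule ccontr)
    assume "\<not> (A \<subseteq> B \<or> B \<subseteq> A)"
    then obtain x y where xy: "x \<in> A - B" "y \<in> B - A" by blast
    have c: "x \<in> carrier R" "y \<in> carrier R"
      using xy hyperideal_mem_closed id(1)[OF AB(1)] id(1)[OF AB(2)] by auto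
    \<comment> \<open>\<open>S\<close> is \<open>(x y) + (A \<inter> B)\<^sup>2\<close>; it contains \<open>x y\<close> but neither \<open>x\<^sup>2\<close> nor \<open>y\<^sup>2\<close>.\<close>
    define P where "P = (\<lambda>u. (x \<otimes>\<^bsub>R\<^esub> y) \<otimes>\<^bsub>R\<^esub> u) ` carrier R"
    define S where "S = (\<Union>i \<in> P. \<Union>j \<in> hsquare (A \<inter> B). i \<uplus>\<^bsub>R\<^esub> j)"
    note C = sq[OF Int[OF AB]]
    have P: "hyperideal R P" unfolding P_def
      using hyperideal_mult_image hyperideal_carrier c by blast
    have S: "hyperideal R S" unfolding S_def by (rule hyperideal_sum[OF P id(1)[OF C]])
    have CS: "hsquare (A \<inter> B) \<subseteq> S"
    proof
      fix u assume u: "u \<in> hsquare (A \<inter> B)"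
      then have "u \<in> \<zero>\<^bsub>R\<^esub> \<uplus>\<^bsub>R\<^esub> u"
        using hzero_hadd hyperideal_mem_closed id(1)[OF C] by auto
      then show "u \<in> S" using u hyperideal_hzero[OF P] by (auto simp: S_def)
    qed
    have xyS: "x \<otimes>\<^bsub>R\<^esub> y \<in> S"
    proof -
      have "x \<otimes>\<^bsub>R\<^esub> y \<in> P"
        unfolding P_def using c by (intro image_eqI[of _ _ "\<one>\<^bsub>R\<^esub>"]) auto
      moreover have "x \<otimes>\<^bsub>R\<^esub> y \<in> (x \<otimes>\<^bsub>R\<^esub> y) \<uplus>\<^bsub>R\<^esub> \<zero>\<^bsub>R\<^esub>"
        using c hzero_closed hzero_hadd[of "x \<otimes>\<^bsub>R\<^esub> y"] hadd_comm[of "x \<otimes>\<^bsub>R\<^esub> y" "\<zero>\<^bsub>R\<^esub>"] by simp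
      ultimately show ?thesis
        unfolding S_def using hyperideal_hzero[OF id(1)[OF C]] by blast
    qed
    have nx: "x \<otimes>\<^bsub>R\<^esub> x \<notin> S"
      using square_notin_hypervaluation_sum[OF id(1)[OF AB(1)] id(1)[OF AB(2)]
          val[OF Int[OF AB]] xy(1)] xy(2)
      unfolding S_def P_def by blast
    have ny: "y \<otimes>\<^bsub>R\<^esub> y \<notin> S"
      using square_notin_hypervaluation_sum[OF id(1)[OF AB(2)] id(1)[OF AB(1)]
          val[OF Int[OF AB(2,1)]] xy(2), of x] xy(1) m_comm[OF c] Int_commute[of A B]
      unfolding S_def P_def by simp
    have "\<one>\<^bsub>R\<^esub> \<notin> S" using nx c hyperideal_proper_iff[OF S] by auto
    then have "S \<in> \<Delta>"
      using primary_hyperideal_of_superset[OF loc _ CS S] C \<Delta> by blast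
    then show False
      using square_in_hypervaluation_hyperideal[OF val c xyS] nx ny by blast
  qed
  moreover have "prime_hyperideal R (\<Inter>\<Delta>)"
    unfolding prime_hyperideal_def
  proof (intro conjI ballI impI)
    show "hyperideal R (\<Inter>\<Delta>)" using hyperideal_Inter id(1) \<open>M \<in> \<Delta>\<close> by blast
    show "\<Inter>\<Delta> \<noteq> carrier R" using id(2) \<open>M \<in> \<Delta>\<close> one_closed by blast
    show "a \<in> \<Inter>\<Delta> \<or> b \<in> \<Inter>\<Delta>"
      if ab: "a \<in> carrier R" "b \<in> carrier R" "a \<otimes>\<^bsub>R\<^esub> b \<in> \<Inter>\<Delta>" for a b
    proof (rule ccontr)
      assume "\<not> (a \<in> \<Inter>\<Delta> \<or> b \<in> \<Inter>\<Delta>)"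
      then obtain A B where AB: "A \<in> \<Delta>" "a \<notin> A" "B \<in> \<Delta>" "b \<notin> B" by blast
      then have "a \<otimes>\<^bsub>R\<^esub> b \<notin> hsquare (A \<inter> B)"
        using mult_notin_hsquare[OF val[OF Int]] ab by blast
      then show False using ab(3) sq[OF Int[OF AB(1,3)]] by blast
    qed
  qed
  ultimately show ?thesis by simp
qed

end
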